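(* Let $(\mathfrak{g},D)$ be a difference Lie algebra and $(V,T,\theta)$ a representation of it. Let $G$ be the connected and simply connected Lie group with Lie algebra $\mathfrak{g}$, let $(G,\mathcal{D})$ be the difference Lie group integrating $(\mathfrak{g},D)$, and let $\Theta:G\to GL(V)$ be the Lie group homomorphism integrating the Lie algebra homomorphism $\theta:\mathfrak{g}\to\mathfrak{gl}(V)$ (i.e. $\Theta_{*e_G}=\theta$). Then $(V,T,\Theta)$ is a representation of the difference Lie group $(G,\mathcal{D})$.
   Context: A difference operator on a Lie group $G$ is a smooth map $\mathcal{D}:G\to G$ with $\mathcal{D}(gh)=\mathcal{D}(g)\,g\,\mathcal{D}(h)\,g^{-1}$ for all $g,h\in G$; the pair $(G,\mathcal{D})$ is called a difference Lie group. A representation $(V,T,\Theta)$ of $(G,\mathcal{D})$ consists of a finite-dimensional real vector space $V$, a linear map $T:V\to V$ and a Lie group homomorphism $\Theta:G\to GL(V)$ such that $T(\Theta(g)u)+\Theta(g)u=\Theta(\mathcal{D}(g)g)T(u)+\Theta(\mathcal{D}(g)g)u$ for all $g\in G$, $u\in V$. A difference operator on a (finite-dimensional real) Lie algebra $\mathfrak{g}$ is a linear map $D:\mathfrak{g}\to\mathfrak{g}$ with $D([x,y])=[D(x),y]+[x,D(y)]+[D(x),D(y)]$ for all $x,y\in\mathfrak{g}$; the pair $(\mathfrak{g},D)$ is called a difference Lie algebra. A representation $(V,T,\theta)$ of $(\mathfrak{g},D)$ consists of a finite-dimensional real vector space $V$, a linear map $T:V\to V$ and a Lie algebra representation $\theta:\mathfrak{g}\to\mathfrak{gl}(V)$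 such that $T(\theta(x)u)=\theta(D(x))u+\theta(x)T(u)+\theta(D(x))T(u)$ for all $x\in\mathfrak{g}$, $u\in V$. The integration of a difference Lie algebra $(\mathfrak{g},D)$ is the difference Lie group $(G,\mathcal{D})$, where $G$ is the connected and simply connected Lie group with Lie algebra $\mathfrak{g}$ and $\mathcal{D}$ is the difference operator on $G$ with $\mathcal{D}_{*e_G}=D$ (such a $\mathcal{D}$ exists and is unique). *)

theory Defs
  imports "HOL-Analysis.Analysis" "HOL-Algebra.Group"
begin

definition fin_dim :: "'a::real_vector itself \<Rightarrow> bool" where
  "fin_dim _ \<longleftrightarrow> (\<exists>B::'a set. finite B \<and> span B = UNIV)"


section \<open>Smooth manifolds\<close>

text \<open>On an open subset of a finite-dimensional space, \<open>C_k_on k\<close> is the class of \<open>k\<close> times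
  continuously differentiable functions: all directional derivatives of order less than \<open>k\<close> are
  (totally) differentiable and those of order \<open>k\<close> are continuous.\<close>

fun C_k_on :: "nat \<Rightarrow> 'a::real_normed_vector set \<Rightarrow> ('a \<Rightarrow> 'b::real_normed_vector) \<Rightarrow> bool" where
  "C_k_on 0 S f \<longleftrightarrow> continuous_on S f"
| "C_k_on (Suc k) S f \<longleftrightarrow>
     (\<forall>x\<in>S. f differentiable (at x)) \<and> (\<forall>v. C_k_on k S (\<lambda>x. frechet_derivative f (at x) v))"

definition C_inf_on :: "'a::real_normed_vector set \<Rightarrow> ('a \<Rightarrow> 'b::real_normed_vector) \<Rightarrow> bool" where
  "C_inf_on S f \<longleftrightarrow> (\<forall>k. C_k_on k S f)"

text \<open>A topological space with an atlas of charts \<open>(U, \<phi>)\<close> into the model space \<open>'e\<close>; only the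
  values of \<open>\<phi>\<close> on \<open>U\<close> matter. The atlas need not be maximal.\<close>

record ('a, 'e) mfd =
  mtop :: "'a topology"
  atlas :: "('a set \<times> ('a \<Rightarrow> 'e)) set"

definition is_chart :: "'a topology \<Rightarrow> 'a set \<Rightarrow> ('a \<Rightarrow> 'e::real_normed_vector) \<Rightarrow> bool" where
  "is_chart X U \<phi> \<longleftrightarrow> openin X U \<and> open (\<phi> ` U) \<and>
     homeomorphic_map (subtopology X U) (top_of_set (\<phi> ` U)) \<phi>"

definition smooth_manifold :: "('a, 'e::real_normed_vector) mfd \<Rightarrow> bool" where
  "smooth_manifold M \<longleftrightarrow>
     fin_dim TYPE('e) \<and> Hausdorff_space (mtop M) \<and> second_countable (mtop M) \<and>
     (\<forall>(U, \<phi>)\<in>atlas M. is_chart (mtop M) U \<phi>) \<and>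
     (\<Union>(U, \<phi>)\<in>atlas M. U) = topspace (mtop M) \<and>
     (\<forall>(U, \<phi>)\<in>atlas M. \<forall>(V, \<psi>)\<in>atlas M. C_inf_on (\<phi> ` (U \<inter> V)) (\<psi> \<circ> inv_into U \<phi>))"

definition smooth_map ::
  "('a, 'e::real_normed_vector) mfd \<Rightarrow> ('b, 'f::real_normed_vector) mfd \<Rightarrow> ('a \<Rightarrow> 'b) \<Rightarrow> bool" where
  "smooth_map M N F \<longleftrightarrow> continuous_map (mtop M) (mtop N) F \<and>
     (\<forall>(U, \<phi>)\<in>atlas M. \<forall>(V, \<psi>)\<in>atlas N.
        C_inf_on (\<phi> ` (U \<inter> F -` V)) (\<psi> \<circ> F \<circ> inv_into U \<phi>))"

definition prod_mfd :: "('a, 'e) mfd \<Rightarrow> ('b, 'f) mfd \<Rightarrow> ('a \<times> 'b, 'e \<times> 'f) mfd" where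
  "prod_mfd M N = \<lparr>mtop = prod_topology (mtop M) (mtop N),
     atlas = {(U \<times> V, map_prod \<phi> \<psi>) | U \<phi> V \<psi>. (U, \<phi>) \<in> atlas M \<and> (V, \<psi>) \<in> atlas N}\<rparr>"

definition open_mfd :: "'a::real_normed_vector set \<Rightarrow> ('a, 'a) mfd" where
  "open_mfd S = \<lparr>mtop = top_of_set S, atlas = {(S, id)}\<rparr>"

definition smooth_fun :: "('a, 'e::real_normed_vector) mfd \<Rightarrow> ('a \<Rightarrow> real) \<Rightarrow> bool" where
  "smooth_fun M f \<longleftrightarrow> smooth_map M (open_mfd UNIV) f"

definition simply_connected_space :: "'a topology \<Rightarrow> bool" where
  "simply_connected_space X \<longleftrightarrow> path_connected_space X \<and>
     (\<forall>p. pathin X p \<and> p 1 = p 0 \<longrightarrow>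
        homotopic_with (\<lambda>q. q 0 = p 0 \<and> q 1 = p 0) (top_of_set {0..1}) X p (\<lambda>_. p 0))"


section \<open>Tangent spaces\<close>

text \<open>Tangent vectors at \<open>p\<close> are the derivations at \<open>p\<close> of the algebra of smooth real functions.
  Here they are total functionals, so they are fixed to be 0 on functions that are not smooth.
  The values of \<open>f\<close> off the manifold do not matter: if \<open>f\<close> vanishes on the manifold then
  \<open>f = f \<cdot> \<chi>\<close> with \<open>\<chi>\<close> the indicator function of the complement, and the product rule
  gives \<open>v f = 0\<close>.\<close>

definition tangent_space ::
  "('a, 'e::real_normed_vector) mfd \<Rightarrow> 'a \<Rightarrow> (('a \<Rightarrow> real) \<Rightarrow> real) set" where
  "tangent_space M p = {v.
     (\<forall>f. \<not> smooth_fun M f \<longrightarrow> v f = 0) \<and>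
     (\<forall>f g. smooth_fun M f \<and> smooth_fun M g \<longrightarrow> v (\<lambda>x. f x + g x) = v f + v g) \<and>
     (\<forall>c f. smooth_fun M f \<longrightarrow> v (\<lambda>x. c * f x) = c * v f) \<and>
     (\<forall>f g. smooth_fun M f \<and> smooth_fun M g \<longrightarrow> v (\<lambda>x. f x * g x) = f p * v g + g p * v f)}"

text \<open>The differential of \<open>F\<close> at the base point of \<open>v\<close>, applied to \<open>v\<close>.\<close>

definition differential ::
  "('b, 'f::real_normed_vector) mfd \<Rightarrow> ('a \<Rightarrow> 'b) \<Rightarrow> (('a \<Rightarrow> real) \<Rightarrow> real) \<Rightarrow> (('b \<Rightarrow> real) \<Rightarrow> real)"
  where "differential N F v = (\<lambda>f. if smooth_fun N f then v (f \<circ> F) else 0)"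

text \<open>The canonical identification of a vector space with the tangent space at \<open>p\<close> of its open
  subset \<open>S\<close>.\<close>

definition vec_tangent :: "'a::real_normed_vector set \<Rightarrow> 'a \<Rightarrow> 'a \<Rightarrow> (('a \<Rightarrow> real) \<Rightarrow> real)" where
  "vec_tangent S p a =
     (\<lambda>f. if smooth_fun (open_mfd S) f then frechet_derivative f (at p) a else 0)"


section \<open>Lie groups and Lie algebras\<close>

record ('a, 'e) lgroup = "'a monoid" +
  mfd :: "('a, 'e) mfd"

definition lie_group :: "('a, 'e::real_normed_vector) lgroup \<Rightarrow> bool" where
  "lie_group G \<longleftrightarrow> group G \<and> smooth_manifold (mfd G) \<and> topspace (mtop (mfd G)) = carrier G \<and>
     smooth_map (prod_mfd (mfd G) (mfd G)) (mfd G) (\<lambda>(g, h). g \<otimes>\<^bsub>G\<^esub> h) \<and>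
     smooth_map (mfd G) (mfd G) (\<lambda>g. inv\<^bsub>G\<^esub> g)"

definition lie_group_hom ::
  "('a, 'e::real_normed_vector) lgroup \<Rightarrow> ('b, 'f::real_normed_vector) lgroup \<Rightarrow> ('a \<Rightarrow> 'b) \<Rightarrow> bool"
  where "lie_group_hom G H F \<longleftrightarrow> F \<in> hom G H \<and> smooth_map (mfd G) (mfd H) F"

text \<open>On a finite-dimensional normed space \<open>'v\<close> all linear endomorphisms are bounded, so
  \<open>'v \<Rightarrow>\<^sub>L 'v\<close> is \<open>gl('v)\<close>, and \<open>GL('v)\<close> is the open submanifold of its
  invertible elements.\<close>

definition GL_carrier :: "('v::real_normed_vector \<Rightarrow>\<^sub>L 'v) set" where
  "GL_carrier = {A. \<exists>B. A o\<^sub>L B = id_blinfun \<and> B o\<^sub>L A = id_blinfun}"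

definition GL :: "('v::real_normed_vector \<Rightarrow>\<^sub>L 'v, 'v \<Rightarrow>\<^sub>L 'v) lgroup" where
  "GL = \<lparr>carrier = GL_carrier, monoid.mult = (o\<^sub>L), one = id_blinfun, mfd = open_mfd GL_carrier\<rparr>"

definition lie_algebra :: "('l::real_vector \<Rightarrow> 'l \<Rightarrow> 'l) \<Rightarrow> bool" where
  "lie_algebra br \<longleftrightarrow> fin_dim TYPE('l) \<and>
     (\<forall>x. linear (br x)) \<and> (\<forall>y. linear (\<lambda>x. br x y)) \<and> (\<forall>x. br x x = 0) \<and>
     (\<forall>x y z. br x (br y z) + br y (br z x) + br z (br x y) = 0)"

definition lie_algebra_rep ::
  "('l::real_vector \<Rightarrow> 'l \<Rightarrow> 'l) \<Rightarrow> ('l \<Rightarrow> 'v::real_normed_vector \<Rightarrow>\<^sub>L 'v) \<Rightarrow> bool" where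
  "lie_algebra_rep br \<theta> \<longleftrightarrow> linear \<theta> \<and>
     (\<forall>x y. \<theta> (br x y) = (\<theta> x o\<^sub>L \<theta> y) - (\<theta> y o\<^sub>L \<theta> x))"

text \<open>The bracket on the tangent space at the identity. The left-invariant vector field extending
  \<open>v\<close> sends \<open>f\<close> to \<open>\<lambda>g. v (\<lambda>h. f (g h))\<close>; the bracket of \<open>v\<close> and \<open>w\<close> is the value at the
  identity of the commutator of their left-invariant vector fields.\<close>

definition lie_group_bracket :: "('a, 'e::real_normed_vector) lgroup \<Rightarrow>
    (('a \<Rightarrow> real) \<Rightarrow> real) \<Rightarrow> (('a \<Rightarrow> real) \<Rightarrow> real) \<Rightarrow> (('a \<Rightarrow> real) \<Rightarrow> real)" where
  "lie_group_bracket G v w = (\<lambda>f. if smooth_fun (mfd G) f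
     then v (\<lambda>g. w (\<lambda>h. f (g \<otimes>\<^bsub>G\<^esub> h))) - w (\<lambda>g. v (\<lambda>h. f (g \<otimes>\<^bsub>G\<^esub> h))) else 0)"

text \<open>\<open>\<iota>\<close> identifies the Lie algebra \<open>('l, br)\<close> with the Lie algebra of \<open>G\<close>.\<close>

definition is_lie_algebra_of :: "('l::real_vector \<Rightarrow> 'l \<Rightarrow> 'l) \<Rightarrow>
    ('a, 'e::real_normed_vector) lgroup \<Rightarrow> ('l \<Rightarrow> ('a \<Rightarrow> real) \<Rightarrow> real) \<Rightarrow> bool" where
  "is_lie_algebra_of br G \<iota> \<longleftrightarrow>
     bij_betw \<iota> UNIV (tangent_space (mfd G) \<one>\<^bsub>G\<^esub>) \<and>
     (\<forall>x y. \<iota> (x + y) = (\<lambda>f. \<iota> x f + \<iota> y f)) \<and>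
     (\<forall>c x. \<iota> (c *\<^sub>R x) = (\<lambda>f. c * \<iota> x f)) \<and>
     (\<forall>x y. \<iota> (br x y) = lie_group_bracket G (\<iota> x) (\<iota> y))"


section \<open>Difference Lie groups and difference Lie algebras\<close>

definition difference_lie_group :: "('a, 'e::real_normed_vector) lgroup \<Rightarrow> ('a \<Rightarrow> 'a) \<Rightarrow> bool" where
  "difference_lie_group G \<D> \<longleftrightarrow> lie_group G \<and> smooth_map (mfd G) (mfd G) \<D> \<and>
     (\<forall>g\<in>carrier G. \<forall>h\<in>carrier G.
        \<D> (g \<otimes>\<^bsub>G\<^esub> h) = \<D> g \<otimes>\<^bsub>G\<^esub> g \<otimes>\<^bsub>G\<^esub> \<D> h \<otimes>\<^bsub>G\<^esub> inv\<^bsub>G\<^esub> g)"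

definition difference_lie_group_rep :: "('a, 'e::real_normed_vector) lgroup \<Rightarrow> ('a \<Rightarrow> 'a) \<Rightarrow>
    ('v::real_normed_vector \<Rightarrow> 'v) \<Rightarrow> ('a \<Rightarrow> 'v \<Rightarrow>\<^sub>L 'v) \<Rightarrow> bool" where
  "difference_lie_group_rep G \<D> T \<Theta> \<longleftrightarrow>
     fin_dim TYPE('v) \<and> linear T \<and> lie_group_hom G GL \<Theta> \<and>
     (\<forall>g\<in>carrier G. \<forall>u. T (\<Theta> g u) + \<Theta> g u = \<Theta> (\<D> g \<otimes>\<^bsub>G\<^esub> g) (T u) + \<Theta> (\<D> g \<otimes>\<^bsub>G\<^esub> g) u)"

definition difference_lie_algebra :: "('l::real_vector \<Rightarrow> 'l \<Rightarrow> 'l) \<Rightarrow> ('l \<Rightarrow> 'l) \<Rightarrow> bool" where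
  "difference_lie_algebra br D \<longleftrightarrow> lie_algebra br \<and> linear D \<and>
     (\<forall>x y. D (br x y) = br (D x) y + br x (D y) + br (D x) (D y))"

definition difference_lie_algebra_rep :: "('l::real_vector \<Rightarrow> 'l \<Rightarrow> 'l) \<Rightarrow> ('l \<Rightarrow> 'l) \<Rightarrow>
    ('v::real_normed_vector \<Rightarrow> 'v) \<Rightarrow> ('l \<Rightarrow> 'v \<Rightarrow>\<^sub>L 'v) \<Rightarrow> bool" where
  "difference_lie_algebra_rep br D T \<theta> \<longleftrightarrow>
     fin_dim TYPE('v) \<and> linear T \<and> lie_algebra_rep br \<theta> \<and>
     (\<forall>x u. T (\<theta> x u) = \<theta> (D x) u + \<theta> x (T u) + \<theta> (D x) (T u))"

text \<open>\<open>(G, \<D>)\<close> is the integration of \<open>('l, br, D)\<close>, where \<open>\<iota>\<close> is the identification of the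
  Lie algebra with the tangent space of \<open>G\<close> at the identity.\<close>

definition integrates_difference_lie_algebra :: "('l::real_vector \<Rightarrow> 'l \<Rightarrow> 'l) \<Rightarrow> ('l \<Rightarrow> 'l) \<Rightarrow>
    ('a, 'e::real_normed_vector) lgroup \<Rightarrow> ('a \<Rightarrow> 'a) \<Rightarrow> ('l \<Rightarrow> ('a \<Rightarrow> real) \<Rightarrow> real) \<Rightarrow> bool" where
  "integrates_difference_lie_algebra br D G \<D> \<iota> \<longleftrightarrow>
     difference_lie_group G \<D> \<and>
     connected_space (mtop (mfd G)) \<and> simply_connected_space (mtop (mfd G)) \<and>
     is_lie_algebra_of br G \<iota> \<and>
     (\<forall>x. differential (mfd G) \<D> (\<iota> x) = \<iota> (D x))"

definition integrates_lie_algebra_rep :: "('a, 'e::real_normed_vector) lgroup \<Rightarrow>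
    ('l::real_vector \<Rightarrow> ('a \<Rightarrow> real) \<Rightarrow> real) \<Rightarrow>
    ('l \<Rightarrow> 'v::real_normed_vector \<Rightarrow>\<^sub>L 'v) \<Rightarrow> ('a \<Rightarrow> 'v \<Rightarrow>\<^sub>L 'v) \<Rightarrow> bool" where
  "integrates_lie_algebra_rep G \<iota> \<theta> \<Theta> \<longleftrightarrow> lie_group_hom G GL \<Theta> \<and>
     (\<forall>x. differential (mfd GL) \<Theta> (\<iota> x) = vec_tangent GL_carrier id_blinfun (\<theta> x))"

end

theory Submission
  imports Defs
begin

text \<open>With \<open>S = T + id\<close> and the homomorphism \<open>\<Phi> g = \<Theta> (\<D> g \<otimes> g)\<close>, the claim is \<open>S \<Theta>(g) = \<Phi>(g) S\<close>. The
  map \<open>K g = \<Phi>(g)\<^sup>-\<^sup>1 S \<Theta>(g)\<close> satisfies \<open>K (h g) = \<Phi>(g)\<^sup>-\<^sup>1 K(h) \<Theta>(g)\<close>, so its derivative at any point is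
  determined by the one at the identity, which vanishes by the infinitesimal relation
  \<open>S \<theta>(x) = (\<theta>(D x) + \<theta>(x)) S\<close>. Hence \<open>K\<close> is locally constant, and constant by connectedness.\<close>


section \<open>Finite-dimensional normed spaces\<close>

text \<open>\<open>S\<close> may be singular (for \<open>T = - id\<close> it is 0), so the claim
  cannot be reduced to uniqueness of a homomorphism with a given differential by conjugating with
  \<open>S\<close>. The map \<open>K\<close> avoids this: it inverts only \<Phi>, and its law under
  right multiplication of the argument is why right translations carry the derivative from the
  identity to other points. Two encodings shape the rest. Tangent vectors are functionals on real
  functions, so an identity between operators at the identity of \<open>G\<close> must be tested on
  bounded linear functionals \<open>l\<close>, through the smooth functions
  \<open>l (\<Theta> g)\<close>. And \<open>fin_dim\<close> only provides a finite spanning set of a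
  normed type, so bounded coordinate functionals are built first. They make linear maps bounded,
  make \<open>GL_carrier\<close> open and give the chain rule for \<open>C_k_on\<close>, whose
  derivatives are taken in fixed directions only.\<close>

lemma independent_coordinates_bounded:
  fixes B :: "'a::real_normed_vector set"
  assumes "finite B" "independent B"
  shows "\<exists>C>0. \<forall>c. (\<Sum>b\<in>B. \<bar>c b\<bar>) \<le> C * norm (\<Sum>b\<in>B. c b *\<^sub>R b)"
  using assms
proof (induction B rule: finite_induct)
  case empty
  then show ?case by (auto intro: exI[of _ 1])
next
  case (insert b0 B)
  have ind: "independent B" and b0: "b0 \<notin> span B"
    using insert.prems insert.hyps(2) by (simp_all add: independent_insert)
  obtain C where C: "C > 0" "\<And>c. (\<Sum>b\<in>B. \<bar>c b\<bar>) \<le> C * norm (\<Sum>b\<in>B. c b *\<^sub>R b)"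
    using insert.IH[OF ind] by blast
  \<comment> \<open>By the induction hypothesis \<open>span B\<close> is complete, hence closed, so \<open>b0\<close> has positive
    distance from it; this bounds the coordinate at \<open>b0\<close>.\<close>
  have "complete (span B)"
  proof (rule completeI)
    fix s :: "nat \<Rightarrow> 'a"
    assume s: "\<forall>n. s n \<in> span B" and cau: "Cauchy s"
    have "\<forall>n. \<exists>c. s n = (\<Sum>b\<in>B. c b *\<^sub>R b)"
      using s insert.hyps(1) by (auto simp: span_finite)
    then obtain c where c: "\<And>n. s n = (\<Sum>b\<in>B. c n b *\<^sub>R b)" by metis
    have coord: "\<bar>c m b - c n b\<bar> \<le> C * norm (s m - s n)" if "b \<in> B" for m n b
    proof -
      have "\<bar>c m b - c n b\<bar> \<le> (\<Sum>b\<in>B. \<bar>c m b - c n b\<bar>)"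
        by (rule member_le_sum[OF that]) (use insert.hyps(1) in auto)
      also have "\<dots> \<le> C * norm (\<Sum>b\<in>B. (c m b - c n b) *\<^sub>R b)" by (rule C(2))
      also have "(\<Sum>b\<in>B. (c m b - c n b) *\<^sub>R b) = s m - s n"
        by (simp add: c scaleR_left_diff_distrib sum_subtractf)
      finally show ?thesis .
    qed
    have "Cauchy (\<lambda>n. c n b)" if "b \<in> B" for b
    proof (rule metric_CauchyI)
      fix e :: real assume "e > 0"
      then have "e / C > 0" using C(1) by simp
      from metric_CauchyD[OF cau this] obtain M where
        M: "\<And>m n. m \<ge> M \<Longrightarrow> n \<ge> M \<Longrightarrow> dist (s m) (s n) < e / C" by blast
      show "\<exists>M. \<forall>m\<ge>M. \<forall>n\<ge>M. dist (c m b) (c n b) < e"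
      proof (intro exI[of _ M] allI impI)
        fix m n assume "m \<ge> M" "n \<ge> M"
        then have "C * norm (s m - s n) < e"
          using M[of m n] C(1) by (simp add: dist_norm field_simps)
        then show "dist (c m b) (c n b) < e"
          using coord[OF that, of m n] by (simp add: dist_real_def)
      qed
    qed
    then have "\<forall>b\<in>B. \<exists>l. (\<lambda>n. c n b) \<longlonglongrightarrow> l"
      by (simp add: Cauchy_convergent_iff convergent_def)
    then obtain l where l: "\<And>b. b \<in> B \<Longrightarrow> (\<lambda>n. c n b) \<longlonglongrightarrow> l b" by metis
    have "s \<longlonglongrightarrow> (\<Sum>b\<in>B. l b *\<^sub>R b)"
      unfolding c[abs_def] by (intro tendsto_intros l)
    moreover have "(\<Sum>b\<in>B. l b *\<^sub>R b) \<in> span B"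
      by (intro span_sum span_scale span_base)
    ultimately show "\<exists>l\<in>span B. s \<longlonglongrightarrow> l" by blast
  qed
  then have cl: "closed (span B)" by (rule complete_imp_closed)
  define d where "d = infdist b0 (span B)"
  have ne: "span B \<noteq> {}" using span_zero by blast
  have d: "d > 0"
    using in_closed_iff_infdist_zero[OF cl ne, of b0] b0 infdist_nonneg[of b0 "span B"]
    unfolding d_def by linarith
  \<comment> \<open>Dividing by \<open>t\<close> turns the vector into \<open>b0\<close> minus an
    element of \<open>span B\<close>, whose norm is at least the distance \<open>d\<close>.\<close>
  have first: "\<bar>t\<bar> * d \<le> norm (t *\<^sub>R b0 + w)" if w: "w \<in> span B" for t w
  proof (cases "t = 0")
    case False
    have "- (w /\<^sub>R t) \<in> span B" using w by (intro span_neg span_scale)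
    then have "d \<le> dist b0 (- (w /\<^sub>R t))" unfolding d_def by (rule infdist_le)
    then have "\<bar>t\<bar> * d \<le> \<bar>t\<bar> * norm (b0 + w /\<^sub>R t)" by (simp add: dist_norm mult_left_mono)
    also have "\<dots> = norm (t *\<^sub>R (b0 + w /\<^sub>R t))" by simp
    also have "t *\<^sub>R (b0 + w /\<^sub>R t) = t *\<^sub>R b0 + w" using False by (simp add: scaleR_add_right)
    finally show ?thesis .
  qed simp
  \<comment> \<open>\<open>1 / d\<close> pays for the coordinate at \<open>b0\<close>. The others
    cost \<open>C * norm w\<close>, and \<open>norm w\<close> exceeds the norm of the whole sum by
    at most the \<open>b0\<close> term, which contributes \<open>norm b0 / d\<close>.\<close>
  define E where "E = 1 / d + C * (1 + norm b0 / d)"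
  have "E > 0" unfolding E_def using d C(1) by (intro add_pos_nonneg) auto
  moreover have "(\<Sum>b\<in>insert b0 B. \<bar>c b\<bar>) \<le> E * norm (\<Sum>b\<in>insert b0 B. c b *\<^sub>R b)" for c
  proof -
    define w where "w = (\<Sum>b\<in>B. c b *\<^sub>R b)"
    define N where "N = norm (c b0 *\<^sub>R b0 + w)"
    have w: "w \<in> span B" unfolding w_def by (intro span_sum span_scale span_base)
    have c0: "\<bar>c b0\<bar> \<le> N / d" using first[OF w] d unfolding N_def by (simp add: field_simps)
    have "norm w \<le> N + norm (c b0 *\<^sub>R b0)"
      unfolding N_def using norm_triangle_ineq4[of "c b0 *\<^sub>R b0 + w" "c b0 *\<^sub>R b0"] by simp
    also have "\<dots> \<le> N + N / d * norm b0" using mult_right_mono[OF c0 norm_ge_zero[of b0]] by simp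
    finally have "C * norm w \<le> C * (N + N / d * norm b0)" using C(1) by simp
    moreover have "(\<Sum>b\<in>B. \<bar>c b\<bar>) \<le> C * norm w" unfolding w_def by (rule C(2))
    ultimately have "\<bar>c b0\<bar> + (\<Sum>b\<in>B. \<bar>c b\<bar>) \<le> N / d + C * (N + N / d * norm b0)"
      using c0 by linarith
    also have "\<dots> = E * N" unfolding E_def by (simp add: algebra_simps)
    finally show ?thesis
      using insert.hyps unfolding N_def w_def by simp
  qed
  ultimately show ?case by blast
qed

text \<open>The coordinate estimate for a basis is exactly the boundedness of each coordinate. For
  \<open>b\<close> outside \<open>B\<close> the coordinate is 0, so boundedness can be claimed for
  every \<open>b\<close>.\<close>

lemma fin_dim_coordinates:
  assumes "fin_dim TYPE('a::real_normed_vector)"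
  obtains B :: "'a::real_normed_vector set" and c :: "'a \<Rightarrow> 'a \<Rightarrow> real"
  where "finite B" "independent B" "span B = UNIV"
    "\<And>b. bounded_linear (c b)" "\<And>x. (\<Sum>b\<in>B. c b x *\<^sub>R b) = x"
proof -
  obtain A :: "'a set" where A: "finite A" "span A = UNIV"
    using assms unfolding fin_dim_def by blast
  obtain B where B: "B \<subseteq> A" "independent B" "A \<subseteq> span B"
    using maximal_independent_subset by blast
  have finB: "finite B" using B(1) A(1) finite_subset by blast
  have spB: "span B = UNIV" using span_mono[OF B(3)] A(2) by (simp add: span_span top.extremum_unique)
  define c where "c b x = representation B x b" for b x
  have lin: "linear (c b)" for b
    unfolding c_def using B(2) spB
    by (intro linearI) (simp_all add: representation_add representation_scale)
  have rep: "(\<Sum>b\<in>B. c b x *\<^sub>R b) = x" for x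
    unfolding c_def using B(2) spB finB by (intro sum_representation_eq) auto
  obtain C where C: "C > 0" "\<And>c. (\<Sum>b\<in>B. \<bar>c b\<bar>) \<le> C * norm (\<Sum>b\<in>B. c b *\<^sub>R b)"
    using independent_coordinates_bounded[OF finB B(2)] by blast
  have "bounded_linear (c b)" for b
  proof (rule bounded_linear_intro[where K = C])
    show "c b (x + y) = c b x + c b y" for x y using lin by (rule linear_add)
    show "c b (r *\<^sub>R x) = r *\<^sub>R c b x" for r x using lin by (rule linear_scale)
    show "norm (c b x) \<le> norm x * C" for x
    proof (cases "b \<in> B")
      case True
      have "\<bar>c b x\<bar> \<le> (\<Sum>b\<in>B. \<bar>c b x\<bar>)"
        by (rule member_le_sum[OF True]) (use finB in auto)
      also have "\<dots> \<le> C * norm (\<Sum>b\<in>B. c b x *\<^sub>R b)" by (rule C(2))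
      finally show ?thesis by (simp add: rep mult.commute)
    next
      case False
      then have "c b x = 0" unfolding c_def using representation_ne_zero by blast
      then show ?thesis using C(1) by simp
    qed
  qed
  then show thesis using that finB B(2) spB rep by blast
qed

lemma fin_dim_linear_imp_bounded_linear:
  fixes f :: "'a::real_normed_vector \<Rightarrow> 'b::real_normed_vector"
  assumes "fin_dim TYPE('a)" "linear f"
  shows "bounded_linear f"
proof -
  obtain B :: "'a set" and c where B: "finite B" "\<And>b. bounded_linear (c b)"
    "\<And>x. (\<Sum>b\<in>B. c b x *\<^sub>R b) = x"
    using fin_dim_coordinates[OF assms(1)] by metis
  have eq: "f x = (\<Sum>b\<in>B. c b x *\<^sub>R f b)" for x
    by (subst B(3)[of x, symmetric]) (simp add: linear_sum[OF assms(2)] linear_scale[OF assms(2)])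
  have "bounded_linear (\<lambda>x. \<Sum>b\<in>B. c b x *\<^sub>R f b)"
    by (intro bounded_linear_sum bounded_linear_scaleR_const B)
  then show ?thesis unfolding eq[abs_def, symmetric] by simp
qed

lemma fin_dim_functional_separates:
  fixes x :: "'a::real_normed_vector"
  assumes "fin_dim TYPE('a)" "x \<noteq> 0"
  obtains l :: "'a \<Rightarrow> real" where "bounded_linear l" "l x \<noteq> 0"
proof -
  obtain B :: "'a set" and c where B: "\<And>b. bounded_linear (c b)"
    "\<And>x. (\<Sum>b\<in>B. c b x *\<^sub>R b) = x"
    using fin_dim_coordinates[OF assms(1)] by metis
  have "\<exists>b\<in>B. c b x \<noteq> 0"
    using B(2)[of x] assms(2) by (metis (no_types, lifting) scale_eq_0_iff sum.neutral)
  then show thesis using that B(1) by blast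
qed

text \<open>Injectivity survives a perturbation smaller than the reciprocal norm of a left inverse.
  In finite dimension it gives surjectivity, and the linear inverse is then automatically
  bounded.\<close>

lemma open_GL_carrier:
  assumes fd: "fin_dim TYPE('v::real_normed_vector)"
  shows "open (GL_carrier :: ('v \<Rightarrow>\<^sub>L 'v) set)"
proof -
  obtain B :: "'v set" where B: "finite B" "independent B" "span B = UNIV"
    using fin_dim_coordinates[OF fd] by metis
  \<comment> \<open>Supplies the dimension argument that an injective endomorphism of
    \<open>'v\<close> is surjective.\<close>
  interpret fdv: finite_dimensional_vector_space "scaleR :: real \<Rightarrow> 'v \<Rightarrow> 'v" B
    by unfold_locales
      (use B in \<open>auto simp: span_raw_def[symmetric] dependent_raw_def[symmetric] algebra_simps\<close>)
  show ?thesis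
    unfolding open_dist
  proof
    fix A :: "'v \<Rightarrow>\<^sub>L 'v" assume "A \<in> GL_carrier"
    then obtain A' where A': "A' o\<^sub>L A = id_blinfun" unfolding GL_carrier_def by blast
    \<comment> \<open>The summand 1 keeps the radius meaningful when \<open>norm A' = 0\<close>,
      that is, on the trivial space.\<close>
    define e where "e = 1 / (norm A' + 1)"
    have e: "e > 0" unfolding e_def by (simp add: add_nonneg_pos)
    have "X \<in> GL_carrier" if X: "dist X A < e" for X
    proof -
      have linX: "linear (blinfun_apply X)" by (rule bounded_linear.linear[OF blinfun.bounded_linear_right])
      have "inj (blinfun_apply X)"
      proof (rule linear_injective_0[OF linX, THEN iffD2], intro allI impI)
        fix u assume u: "blinfun_apply X u = 0"
        have "u = A' (A u)" using A' by (metis blinfun_apply_blinfun_compose blinfun_apply_id_blinfun id_apply)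
        also have "\<dots> = - A' ((X - A) u)" using u by (simp add: blinfun.diff_left blinfun.minus_right)
        finally have "norm u \<le> norm A' * (norm (X - A) * norm u)"
          by (metis norm_minus_cancel norm_blinfun order_trans mult_left_mono norm_ge_zero)
        moreover have "norm A' * norm (X - A) < 1"
        proof -
          have "norm (X - A) * (norm A' + 1) < 1"
            using X unfolding e_def by (simp add: dist_norm pos_less_divide_eq add_nonneg_pos)
          then show ?thesis using norm_ge_zero[of "X - A"] by (simp only: distrib_left mult_1_right mult.commute[of "norm A'"])
        qed
        ultimately have "(1 - norm A' * norm (X - A)) * norm u \<le> 0" "0 < 1 - norm A' * norm (X - A)"
          by (simp_all add: algebra_simps)
        then show "u = 0" by (simp add: mult_le_0_iff)
      qed
      moreover from this linX have "surj (blinfun_apply X)"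
        by (intro fdv.linear_inj_imp_surj) (auto simp: linear_def)
      ultimately obtain g where g: "linear g" "g \<circ> blinfun_apply X = id" "blinfun_apply X \<circ> g = id"
        using linear_injective_left_inverse[OF linX] surj_iff by (metis comp_assoc comp_id id_comp)
      then have bg: "bounded_linear g" using fd fin_dim_linear_imp_bounded_linear by blast
      have "X o\<^sub>L Blinfun g = id_blinfun" "Blinfun g o\<^sub>L X = id_blinfun"
        using g(2,3) by (auto intro!: blinfun_eqI simp: bounded_linear_Blinfun_apply[OF bg] fun_eq_iff)
      then show ?thesis unfolding GL_carrier_def by blast
    qed
    then show "\<exists>e>0. \<forall>y. dist y A < e \<longrightarrow> y \<in> GL_carrier" using e by blast
  qed
qed

section \<open>Calculus of \<open>C_k_on\<close>\<close>

lemma C_k_on_subset: "C_k_on k S f \<Longrightarrow> T \<subseteq> S \<Longrightarrow> C_k_on k T f"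
  by (induction k arbitrary: f) (auto intro: continuous_on_subset)

text \<open>On an open set, equal functions have equal derivatives at every point, so the agreement
  passes to all directional derivatives. The rules below compute a derivative only on
  \<open>S\<close> and transfer smoothness through this lemma.\<close>

lemma C_k_on_cong:
  assumes "open S" "\<And>x. x \<in> S \<Longrightarrow> f x = g x" "C_k_on k S f"
  shows "C_k_on k S g"
  using assms(2,3)
proof (induction k arbitrary: f g)
  case 0
  then show ?case using continuous_on_cong[of S S f g] by auto
next
  case (Suc k)
  have d: "f differentiable (at x)" if "x \<in> S" for x using Suc.prems(2) that by simp
  have "g differentiable (at x)" if "x \<in> S" for x
    using d[OF that] has_derivative_transform_within_open[where f = f and g = g, OF _ assms(1) that Suc.prems(1)]
    unfolding differentiable_def by blast
  moreover have "C_k_on k S (\<lambda>x. frechet_derivative g (at x) v)" for v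
  proof (rule Suc.IH)
    show "frechet_derivative f (at x) v = frechet_derivative g (at x) v" if "x \<in> S" for x
      using frechet_derivative_transform_within_open[OF d[OF that] assms(1) that Suc.prems(1)] by simp
    show "C_k_on k S (\<lambda>x. frechet_derivative f (at x) v)" using Suc.prems(2) by simp
  qed
  ultimately show ?case by simp
qed

lemma C_k_on_Union:
  assumes "\<And>A. A \<in> \<A> \<Longrightarrow> open A" "\<And>A. A \<in> \<A> \<Longrightarrow> C_k_on k A f"
  shows "C_k_on k (\<Union>\<A>) f"
  using assms(2)
proof (induction k arbitrary: f)
  case 0
  then show ?case using continuous_on_open_Union[of \<A> f] assms(1) by simp
qed auto

lemma C_k_on_imp_continuous_on: "C_k_on k S f \<Longrightarrow> continuous_on S f"
  by (cases k) (auto intro!: continuous_at_imp_continuous_on differentiable_imp_continuous_within)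

lemma C_k_on_Suc_imp: "C_k_on (Suc k) S f \<Longrightarrow> C_k_on k S f"
proof (induction k arbitrary: f)
  case 0
  then show ?case using C_k_on_imp_continuous_on[of "Suc 0" S f] by simp
next
  case (Suc k)
  then show ?case by (metis C_k_on.simps(2))
qed

lemma C_k_on_const: "C_k_on k S (\<lambda>_. c)"
  by (induction k arbitrary: c) auto

text \<open>The pattern of all closure rules below: the derivative is given by a formula valid on
  \<open>S\<close>, and the induction hypothesis, for arbitrary functions, applies to the terms of
  that formula.\<close>

lemma C_k_on_bounded_linear:
  assumes "bounded_linear l" "open S" "C_k_on k S f"
  shows "C_k_on k S (\<lambda>x. l (f x))"
  using assms(3)
proof (induction k arbitrary: f)
  case 0
  then show ?case using bounded_linear.continuous_on[OF assms(1)] by simp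
next
  case (Suc k)
  have d: "((\<lambda>x. l (f x)) has_derivative (\<lambda>v. l (frechet_derivative f (at x) v))) (at x)"
    if "x \<in> S" for x
    using Suc.prems that
    by (intro bounded_linear.has_derivative[OF assms(1)]) (simp add: frechet_derivative_works[symmetric])
  have "C_k_on k S (\<lambda>x. frechet_derivative (\<lambda>x. l (f x)) (at x) v)" for v
  proof (rule C_k_on_cong[OF assms(2)])
    show "l (frechet_derivative f (at x) v) = frechet_derivative (\<lambda>x. l (f x)) (at x) v"
      if "x \<in> S" for x
      by (rule fun_cong[OF frechet_derivative_at[OF d[OF that]]])
    show "C_k_on k S (\<lambda>x. l (frechet_derivative f (at x) v))" using Suc.prems by (intro Suc.IH) auto
  qed
  then show ?case using d by (auto simp: differentiable_def)
qed

lemma C_k_on_add: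
  assumes "open S" "C_k_on k S f" "C_k_on k S g"
  shows "C_k_on k S (\<lambda>x. f x + g x)"
  using assms(2,3)
proof (induction k arbitrary: f g)
  case 0
  then show ?case by (simp add: continuous_on_add)
next
  case (Suc k)
  let ?h = "\<lambda>x v. frechet_derivative f (at x) v + frechet_derivative g (at x) v"
  have d: "((\<lambda>x. f x + g x) has_derivative ?h x) (at x)" if "x \<in> S" for x
    using Suc.prems that by (intro has_derivative_add) (simp_all add: frechet_derivative_works[symmetric])
  have "C_k_on k S (\<lambda>x. frechet_derivative (\<lambda>x. f x + g x) (at x) v)" for v
  proof (rule C_k_on_cong[OF assms(1)])
    show "?h x v = frechet_derivative (\<lambda>x. f x + g x) (at x) v" if "x \<in> S" for x
      by (rule fun_cong[OF frechet_derivative_at[OF d[OF that]]])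
    show "C_k_on k S (\<lambda>x. ?h x v)" using Suc.prems by (intro Suc.IH) auto
  qed
  then show ?case using d by (auto simp: differentiable_def)
qed

lemma C_k_on_sum:
  assumes "open S" "\<And>i. i \<in> I \<Longrightarrow> C_k_on k S (f i)"
  shows "C_k_on k S (\<lambda>x. \<Sum>i\<in>I. f i x)"
  using assms(2)
  by (induction I rule: infinite_finite_induct) (auto intro: C_k_on_const C_k_on_add[OF assms(1)])

lemma C_k_on_bounded_bilinear:
  assumes "bounded_bilinear p" "open S" "C_k_on k S f" "C_k_on k S g"
  shows "C_k_on k S (\<lambda>x. p (f x) (g x))"
  using assms(3,4)
proof (induction k arbitrary: f g)
  case 0
  then show ?case using bounded_bilinear.continuous_on[OF assms(1)] by simp
next
  case (Suc k)
  let ?h = "\<lambda>x v. p (f x) (frechet_derivative g (at x) v) + p (frechet_derivative f (at x) v) (g x)"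
  have d: "((\<lambda>x. p (f x) (g x)) has_derivative ?h x) (at x)" if "x \<in> S" for x
    using Suc.prems that
    by (intro bounded_bilinear.FDERIV[OF assms(1)]) (simp_all add: frechet_derivative_works[symmetric])
  have "C_k_on k S (\<lambda>x. frechet_derivative (\<lambda>x. p (f x) (g x)) (at x) v)" for v
  proof (rule C_k_on_cong[OF assms(2)])
    show "?h x v = frechet_derivative (\<lambda>x. p (f x) (g x)) (at x) v" if "x \<in> S" for x
      by (rule fun_cong[OF frechet_derivative_at[OF d[OF that]]])
    show "C_k_on k S (\<lambda>x. ?h x v)"
      using Suc.prems C_k_on_Suc_imp[OF Suc.prems(1)] C_k_on_Suc_imp[OF Suc.prems(2)]
      by (intro C_k_on_add[OF assms(2)] Suc.IH) auto
  qed
  then show ?case using d by (auto simp: differentiable_def)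
qed

text \<open>The derivative of the slice in direction \<open>v\<close> is the slice of the derivative
  in direction \<open>(v, 0)\<close>, so the induction stays within slices.\<close>

lemma C_k_on_pair_const:
  fixes f :: "'a::real_normed_vector \<times> 'b::real_normed_vector \<Rightarrow> 'c::real_normed_vector"
  assumes "open T" "\<And>x. x \<in> T \<Longrightarrow> (x, c) \<in> S" "C_k_on k S f"
  shows "C_k_on k T (\<lambda>x. f (x, c))"
  using assms(3)
proof (induction k arbitrary: f)
  case 0
  then show ?case
    using continuous_on_compose2[of S f T "\<lambda>x. (x, c)"] assms(2)
    by (fastforce intro: continuous_intros)
next
  case (Suc k)
  have d: "((\<lambda>x. f (x, c)) has_derivative (\<lambda>v. frechet_derivative f (at (x, c)) (v, 0))) (at x)"
    if "x \<in> T" for x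
  proof (rule has_derivative_compose[where f = "\<lambda>x. (x, c)" and g = f])
    show "((\<lambda>x. (x, c)) has_derivative (\<lambda>v. (v, 0))) (at x)"
      by (auto intro!: derivative_eq_intros)
    show "(f has_derivative frechet_derivative f (at (x, c))) (at (x, c))"
      using Suc.prems assms(2)[OF that] by (simp add: frechet_derivative_works[symmetric])
  qed
  have "C_k_on k T (\<lambda>x. frechet_derivative (\<lambda>x. f (x, c)) (at x) v)" for v
  proof (rule C_k_on_cong[OF assms(1)])
    show "frechet_derivative f (at (x, c)) (v, 0) = frechet_derivative (\<lambda>x. f (x, c)) (at x) v"
      if "x \<in> T" for x
      by (rule fun_cong[OF frechet_derivative_at[OF d[OF that]]])
    show "C_k_on k T (\<lambda>x. frechet_derivative f (at (x, c)) (v, 0))"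
      using Suc.prems by (intro Suc.IH) auto
  qed
  then show ?case using d by (auto simp: differentiable_def)
qed

text \<open>The chain rule differentiates \<open>f\<close> in a direction that varies with
  \<open>x\<close>, whereas \<open>C_k_on\<close> controls fixed directions. Expanding the inner
  derivative in a finite basis gives a sum of scalar functions times derivatives of \<open>f\<close>
  in the fixed directions \<open>b\<close>.\<close>

lemma C_k_on_compose:
  fixes f :: "'b::real_normed_vector \<Rightarrow> 'c::real_normed_vector"
    and g :: "'a::real_normed_vector \<Rightarrow> 'b"
  assumes fd: "fin_dim TYPE('b)" and S: "open S" and gS: "g ` S \<subseteq> U"
    and "C_k_on k U f" "C_k_on k S g"
  shows "C_k_on k S (\<lambda>x. f (g x))"
  using assms(4,5)
proof (induction k arbitrary: f)
  case 0
  then show ?case using continuous_on_compose2[of U f S g] gS by simp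
next
  case (Suc k)
  obtain B :: "'b set" and c where B: "\<And>b. bounded_linear (c b)"
    "\<And>x. (\<Sum>b\<in>B. c b x *\<^sub>R b) = x"
    using fin_dim_coordinates[OF fd] by metis
  let ?h = "\<lambda>x v. \<Sum>b\<in>B. c b (frechet_derivative g (at x) v) *\<^sub>R frechet_derivative f (at (g x)) b"
  have d: "((\<lambda>x. f (g x)) has_derivative ?h x) (at x)" if x: "x \<in> S" for x
  proof -
    have f': "(f has_derivative frechet_derivative f (at (g x))) (at (g x))"
      using Suc.prems x gS by (auto simp: frechet_derivative_works[symmetric])
    have g': "(g has_derivative frechet_derivative g (at x)) (at x)"
      using Suc.prems x by (simp add: frechet_derivative_works[symmetric])
    have lin: "linear (frechet_derivative f (at (g x)))"
      using has_derivative_linear[OF f'] .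
    have eq: "frechet_derivative f (at (g x)) w = (\<Sum>b\<in>B. c b w *\<^sub>R frechet_derivative f (at (g x)) b)" for w
      by (subst B(2)[of w, symmetric]) (simp add: linear_sum[OF lin] linear_scale[OF lin])
    show ?thesis
      by (rule has_derivative_eq_rhs[OF has_derivative_compose[OF g' f']]) (rule ext, rule eq)
  qed
  have "C_k_on k S (\<lambda>x. frechet_derivative (\<lambda>x. f (g x)) (at x) v)" for v
  proof (rule C_k_on_cong[OF S])
    show "?h x v = frechet_derivative (\<lambda>x. f (g x)) (at x) v" if "x \<in> S" for x
      by (rule fun_cong[OF frechet_derivative_at[OF d[OF that]]])
    show "C_k_on k S (\<lambda>x. ?h x v)"
    proof (rule C_k_on_sum[OF S], rule C_k_on_bounded_bilinear[OF bounded_bilinear_scaleR S])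
      fix b
      show "C_k_on k S (\<lambda>x. c b (frechet_derivative g (at x) v))"
        using Suc.prems(2) by (intro C_k_on_bounded_linear[OF B(1) S]) simp
      show "C_k_on k S (\<lambda>x. frechet_derivative f (at (g x)) b)"
        using Suc.prems(1) C_k_on_Suc_imp[OF Suc.prems(2)]
        by (intro Suc.IH[of "\<lambda>y. frechet_derivative f (at y) b"]) simp_all
    qed
  qed
  then show ?case using d by (auto simp: differentiable_def)
qed

section \<open>Smooth maps on manifolds\<close>

text \<open>The target is a linear space without charts, so operator-valued maps can be added,
  multiplied and differentiated directly. Continuity for the manifold topology is kept apart, as
  \<open>smooth_fun_iff\<close> shows.\<close>

definition smooth_vec ::
  "('a, 'e::real_normed_vector) mfd \<Rightarrow> ('a \<Rightarrow> 'b::real_normed_vector) \<Rightarrow> bool" where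
  "smooth_vec M f \<longleftrightarrow> (\<forall>(U, \<phi>)\<in>atlas M. C_inf_on (\<phi> ` U) (f \<circ> inv_into U \<phi>))"

lemma smooth_vecI:
  assumes "\<And>U \<phi> k. (U, \<phi>) \<in> atlas M \<Longrightarrow> C_k_on k (\<phi> ` U) (f \<circ> inv_into U \<phi>)"
  shows "smooth_vec M f"
  using assms unfolding smooth_vec_def C_inf_on_def by auto

lemma smooth_vecD: "smooth_vec M f \<Longrightarrow> (U, \<phi>) \<in> atlas M \<Longrightarrow> C_k_on k (\<phi> ` U) (f \<circ> inv_into U \<phi>)"
  unfolding smooth_vec_def C_inf_on_def by auto

lemma chart_props:
  assumes "smooth_manifold M" "(U, \<phi>) \<in> atlas M"
  shows chart_openin: "openin (mtop M) U"
    and chart_subset: "U \<subseteq> topspace (mtop M)"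
    and chart_inj_on: "inj_on \<phi> U"
    and chart_open_image: "openin (mtop M) W \<Longrightarrow> open (\<phi> ` (U \<inter> W))"
    and chart_openin_preimage: "open O' \<Longrightarrow> openin (mtop M) {x \<in> U. \<phi> x \<in> O'}"
proof -
  have c: "is_chart (mtop M) U \<phi>" using assms unfolding smooth_manifold_def by auto
  then show op: "openin (mtop M) U" unfolding is_chart_def by blast
  then show sub: "U \<subseteq> topspace (mtop M)" by (rule openin_subset)
  have ts: "topspace (subtopology (mtop M) U) = U" using sub by auto
  have h: "homeomorphic_map (subtopology (mtop M) U) (top_of_set (\<phi> ` U)) \<phi>"
    and o: "open (\<phi> ` U)"
    using c unfolding is_chart_def by auto
  show "inj_on \<phi> U" using homeomorphic_imp_injective_map[OF h] ts by simp
  show "open (\<phi> ` (U \<inter> W))" if "openin (mtop M) W"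
  proof -
    have "openin (subtopology (mtop M) U) (U \<inter> W)"
      using that by (metis inf_commute openin_subtopology_Int)
    then have "openin (top_of_set (\<phi> ` U)) (\<phi> ` (U \<inter> W))"
      using homeomorphic_imp_open_map[OF h] unfolding open_map_def by blast
    then show ?thesis using o openin_open_trans by blast
  qed
  show "openin (mtop M) {x \<in> U. \<phi> x \<in> O'}" if "open O'"
  proof -
    have "continuous_map (subtopology (mtop M) U) euclidean \<phi>"
      using homeomorphic_imp_continuous_map[OF h] by (simp add: continuous_map_in_subtopology)
    then have "openin (subtopology (mtop M) U) {x \<in> U. \<phi> x \<in> O'}"
      using openin_continuous_map_preimage[of _ euclidean \<phi> O'] that ts by (metis open_openin)
    then show ?thesis using op openin_trans_full by blast
  qed
qed

lemma chart_open: "smooth_manifold M \<Longrightarrow> (U, \<phi>) \<in> atlas M \<Longrightarrow> open (\<phi> ` U)"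
  unfolding smooth_manifold_def is_chart_def by auto

lemma chart_exists:
  assumes "smooth_manifold M" "p \<in> topspace (mtop M)"
  obtains U \<phi> where "(U, \<phi>) \<in> atlas M" "p \<in> U"
proof -
  have "p \<in> (\<Union>(U, \<phi>)\<in>atlas M. U)" using assms unfolding smooth_manifold_def by simp
  then show thesis using that by auto
qed

lemma chart_inv: "smooth_manifold M \<Longrightarrow> (U, \<phi>) \<in> atlas M \<Longrightarrow> p \<in> U \<Longrightarrow> inv_into U \<phi> (\<phi> p) = p"
  using chart_inj_on by (rule inv_into_f_f)

lemma smooth_vec_has_derivative:
  assumes "smooth_manifold M" "smooth_vec M f" "(U, \<phi>) \<in> atlas M" "p \<in> U"
  shows "((f \<circ> inv_into U \<phi>) has_derivative
    frechet_derivative (f \<circ> inv_into U \<phi>) (at (\<phi> p))) (at (\<phi> p))"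
proof -
  have "C_k_on (Suc 0) (\<phi> ` U) (f \<circ> inv_into U \<phi>)" using assms smooth_vecD by blast
  then show ?thesis using assms(4) by (simp add: frechet_derivative_works[symmetric])
qed

lemma smooth_vec_const: "smooth_vec M (\<lambda>_. c)"
  by (rule smooth_vecI) (simp add: o_def C_k_on_const)

lemma smooth_vec_add:
  assumes "smooth_manifold M" "smooth_vec M f" "smooth_vec M g"
  shows "smooth_vec M (\<lambda>x. f x + g x)"
  using C_k_on_add[OF chart_open[OF assms(1)] smooth_vecD[OF assms(2)] smooth_vecD[OF assms(3)]]
  by (intro smooth_vecI) (simp add: o_def)

lemma smooth_vec_bounded_bilinear:
  assumes "bounded_bilinear b" "smooth_manifold M" "smooth_vec M f" "smooth_vec M g"
  shows "smooth_vec M (\<lambda>x. b (f x) (g x))"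
  using C_k_on_bounded_bilinear[OF assms(1) chart_open[OF assms(2)] smooth_vecD[OF assms(3)]
      smooth_vecD[OF assms(4)]]
  by (intro smooth_vecI) (simp add: o_def)

lemma smooth_vec_bounded_linear:
  assumes "bounded_linear l" "smooth_manifold M" "smooth_vec M f"
  shows "smooth_vec M (\<lambda>x. l (f x))"
  using C_k_on_bounded_linear[OF assms(1) chart_open[OF assms(2)] smooth_vecD[OF assms(3)]]
  by (intro smooth_vecI) (simp add: o_def)

lemma smooth_fun_iff:
  "smooth_fun M f \<longleftrightarrow> continuous_map (mtop M) euclideanreal f \<and> smooth_vec M f"
  unfolding smooth_fun_def smooth_map_def open_mfd_def smooth_vec_def
  by (simp add: case_prod_beta comp_assoc)

lemma smooth_vec_compose:
  fixes F :: "'a \<Rightarrow> 'b" and M :: "('a, 'e::real_normed_vector) mfd"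
    and N :: "('b, 'f::real_normed_vector) mfd"
  assumes M: "smooth_manifold M" and N: "smooth_manifold N"
    and F: "smooth_map M N F" and f: "smooth_vec N f"
  shows "smooth_vec M (\<lambda>x. f (F x))"
proof (rule smooth_vecI)
  fix U \<phi> k assume U: "(U, \<phi>) \<in> atlas M"
  have cF: "continuous_map (mtop M) (mtop N) F" using F unfolding smooth_map_def by blast
  \<comment> \<open>Smoothness is local: on each of these open pieces \<open>F\<close> lands in a
    single chart of \<open>N\<close>, so both factors of the composition can be read in
    coordinates.\<close>
  define \<A> where "\<A> = {\<phi> ` (U \<inter> F -` V) | V \<psi>. (V, \<psi>) \<in> atlas N}"
  have "C_k_on k (\<Union>\<A>) (f \<circ> F \<circ> inv_into U \<phi>)"
  proof (rule C_k_on_Union)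
    fix A assume "A \<in> \<A>"
    then obtain V \<psi> where V: "(V, \<psi>) \<in> atlas N" and A: "A = \<phi> ` (U \<inter> F -` V)"
      unfolding \<A>_def by blast
    have "openin (mtop M) {x \<in> topspace (mtop M). F x \<in> V}"
      using cF chart_openin[OF N V] unfolding continuous_map_def by blast
    moreover have "U \<inter> {x \<in> topspace (mtop M). F x \<in> V} = U \<inter> F -` V"
      using chart_subset[OF M U] by auto
    ultimately show oA: "open A" unfolding A using chart_open_image[OF M U] by metis
    have inA: "F (inv_into U \<phi> y) \<in> V" if "y \<in> A" for y
      using that chart_inv[OF M U] unfolding A by auto
    have "C_k_on k A (\<lambda>y. (f \<circ> inv_into V \<psi>) ((\<psi> \<circ> F \<circ> inv_into U \<phi>) y))"
    proof (rule C_k_on_compose[OF _ oA, where U = "\<psi> ` V"])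
      show "fin_dim TYPE('f)" using N unfolding smooth_manifold_def by blast
      show "(\<psi> \<circ> F \<circ> inv_into U \<phi>) ` A \<subseteq> \<psi> ` V" using inA by auto
      show "C_k_on k (\<psi> ` V) (f \<circ> inv_into V \<psi>)" by (rule smooth_vecD[OF f V])
      show "C_k_on k A (\<psi> \<circ> F \<circ> inv_into U \<phi>)"
        using F U V unfolding A smooth_map_def C_inf_on_def by blast
    qed
    then show "C_k_on k A (f \<circ> F \<circ> inv_into U \<phi>)"
      by (rule C_k_on_cong[OF oA, rotated]) (simp add: chart_inv[OF N V] inA)
  qed
  moreover have "\<phi> ` U \<subseteq> \<Union>\<A>"
  proof
    fix y assume "y \<in> \<phi> ` U"
    then obtain p where p: "p \<in> U" "y = \<phi> p" by blast
    then have "F p \<in> topspace (mtop N)"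
      using cF chart_subset[OF M U] unfolding continuous_map_def by blast
    then obtain V \<psi> where "(V, \<psi>) \<in> atlas N" "F p \<in> V" using chart_exists[OF N] by blast
    then show "y \<in> \<Union>\<A>" unfolding \<A>_def using p by blast
  qed
  ultimately show "C_k_on k (\<phi> ` U) ((\<lambda>x. f (F x)) \<circ> inv_into U \<phi>)"
    using C_k_on_subset by (simp add: o_def)
qed

lemma smooth_fun_compose:
  assumes "smooth_manifold M" "smooth_manifold N" "smooth_map M N F" "smooth_fun N f"
  shows "smooth_fun M (\<lambda>x. f (F x))"
proof -
  have "continuous_map (mtop M) (mtop N) F" using assms(3) unfolding smooth_map_def by blast
  moreover have "continuous_map (mtop N) euclideanreal f" "smooth_vec N f"
    using assms(4) unfolding smooth_fun_iff by blast+
  ultimately show ?thesis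
    using continuous_map_compose[of "mtop M" "mtop N" F euclideanreal f]
      smooth_vec_compose[OF assms(1-3), of f]
    unfolding smooth_fun_iff by (simp add: o_def)
qed

text \<open>Turns a coordinate direction \<open>a\<close> at \<open>p\<close>, pushed forward by
  \<open>R\<close>, into an element of the abstract tangent space. With \<open>R\<close> a
  translation sending \<open>p\<close> to the identity, it can then be matched with a Lie algebra
  element. The value 0 off smooth functions follows the convention of
  \<open>tangent_space\<close>.\<close>

lemma derivation_along_chart:
  assumes M: "smooth_manifold M" and R: "smooth_map M M R"
    and U: "(U, \<phi>) \<in> atlas M" and p: "p \<in> U"
  shows "(\<lambda>f. if smooth_fun M f
      then frechet_derivative ((\<lambda>x. f (R x)) \<circ> inv_into U \<phi>) (at (\<phi> p)) a else 0)
    \<in> tangent_space M (R p)"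
proof -
  let ?d = "\<lambda>f::_ \<Rightarrow> real. frechet_derivative ((\<lambda>x. f (R x)) \<circ> inv_into U \<phi>) (at (\<phi> p))"
  have d: "((\<lambda>y. f (R (inv_into U \<phi> y))) has_derivative ?d f) (at (\<phi> p))" if "smooth_fun M f" for f
    using smooth_vec_has_derivative[OF M smooth_vec_compose[OF M M R] U p, of f] that
    by (simp add: smooth_fun_iff o_def)
  have pp: "inv_into U \<phi> (\<phi> p) = p" by (rule chart_inv[OF M U p])
  have add: "smooth_fun M (\<lambda>x. f x + g x)" "?d (\<lambda>x. f x + g x) a = ?d f a + ?d g a"
    if "smooth_fun M f" "smooth_fun M g" for f g
  proof -
    show "smooth_fun M (\<lambda>x. f x + g x)"
      using that by (simp add: smooth_fun_iff smooth_vec_add[OF M] continuous_map_add)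
    show "?d (\<lambda>x. f x + g x) a = ?d f a + ?d g a"
      using fun_cong[OF frechet_derivative_at[OF has_derivative_add[OF d[OF that(1)] d[OF that(2)]]]]
      by (simp add: o_def)
  qed
  have mult: "smooth_fun M (\<lambda>x. f x * g x)"
    "?d (\<lambda>x. f x * g x) a = f (R p) * ?d g a + g (R p) * ?d f a"
    if "smooth_fun M f" "smooth_fun M g" for f g
  proof -
    show "smooth_fun M (\<lambda>x. f x * g x)"
      using that by (simp add: smooth_fun_iff continuous_map_real_mult
        smooth_vec_bounded_bilinear[OF bounded_bilinear_mult M])
    show "?d (\<lambda>x. f x * g x) a = f (R p) * ?d g a + g (R p) * ?d f a"
      using fun_cong[OF frechet_derivative_at[OF has_derivative_mult[OF d[OF that(1)] d[OF that(2)]]], of a]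
      by (simp add: o_def pp mult.commute)
  qed
  have const: "smooth_fun M (\<lambda>_. c)" "?d (\<lambda>_. c) a = 0" for c :: real
    by (simp_all add: smooth_fun_iff smooth_vec_const o_def)
  have cmult: "smooth_fun M (\<lambda>x. c * f x)" "?d (\<lambda>x. c * f x) a = c * ?d f a"
    if "smooth_fun M f" for c f
    using mult[OF const(1)[of c] that] const(2)[of c] by simp_all
  show ?thesis
    unfolding tangent_space_def mem_Collect_eq
  proof (intro conjI allI impI, goal_cases)
    case 1
    then show ?case by simp
  next
    case (2 f g)
    then have f: "smooth_fun M f" and g: "smooth_fun M g" by auto
    show ?case by (simp only: f g add[OF f g] if_True)
  next
    case (3 c f)
    show ?case by (simp only: 3 cmult[OF 3] if_True)
  next
    case (4 f g)
    then have f: "smooth_fun M f" and g: "smooth_fun M g" by auto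
    show ?case by (simp only: f g mult[OF f g] if_True)
  qed
qed

lemma constant_if_derivative_zero:
  assumes M: "smooth_manifold M" and conn: "connected_space (mtop M)"
    and zero: "\<And>U \<phi> p. (U, \<phi>) \<in> atlas M \<Longrightarrow> p \<in> U \<Longrightarrow>
      ((f \<circ> inv_into U \<phi>) has_derivative (\<lambda>_. 0)) (at (\<phi> p))"
    and pq: "p \<in> topspace (mtop M)" "q \<in> topspace (mtop M)"
  shows "f p = f q"
proof -
  \<comment> \<open>A zero derivative on a ball in a chart makes \<open>f\<close> constant there.
    Allowing any predicate \<open>P\<close> gives openness of a level set and of its complement at
    once.\<close>
  have op: "openin (mtop M) {x \<in> topspace (mtop M). P (f x)}" for P
  proof (subst openin_subopen, intro ballI)
    fix x assume x: "x \<in> {x \<in> topspace (mtop M). P (f x)}"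
    then obtain U \<phi> where U: "(U, \<phi>) \<in> atlas M" "x \<in> U" using chart_exists[OF M] by blast
    then obtain e where e: "e > 0" "ball (\<phi> x) e \<subseteq> \<phi> ` U"
      using chart_open[OF M U(1)] open_contains_ball by (metis imageI)
    have "(f \<circ> inv_into U \<phi>) y = (f \<circ> inv_into U \<phi>) (\<phi> x)" if "y \<in> ball (\<phi> x) e" for y
    proof (rule has_derivative_zero_unique[of "ball (\<phi> x) e"])
      fix z assume "z \<in> ball (\<phi> x) e"
      then obtain r where "r \<in> U" "z = \<phi> r" using e(2) by blast
      then show "((f \<circ> inv_into U \<phi>) has_derivative (\<lambda>_. 0)) (at z within ball (\<phi> x) e)"
        using zero[OF U(1)] has_derivative_at_withinI by blast
    qed (use that e(1) in auto)
    then have eq: "f r = f x" if "r \<in> U" "\<phi> r \<in> ball (\<phi> x) e" for r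
      using that U chart_inv[OF M U(1)] by fastforce
    define N where "N = {r \<in> U. \<phi> r \<in> ball (\<phi> x) e}"
    have "openin (mtop M) N" unfolding N_def by (rule chart_openin_preimage[OF M U(1) open_ball])
    moreover have "x \<in> N" unfolding N_def using U(2) e(1) by simp
    moreover have "N \<subseteq> {x \<in> topspace (mtop M). P (f x)}"
    proof
      fix r assume "r \<in> N"
      then have "r \<in> U" "f r = f x" unfolding N_def using eq by blast+
      then show "r \<in> {x \<in> topspace (mtop M). P (f x)}"
        using x chart_subset[OF M U(1)] by auto
    qed
    ultimately show "\<exists>T. openin (mtop M) T \<and> x \<in> T \<and> T \<subseteq> {x \<in> topspace (mtop M). P (f x)}"
      by blast
  qed
  show ?thesis
  proof (rule ccontr)
    assume "f p \<noteq> f q"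
    let ?E = "{x \<in> topspace (mtop M). f x = f p}" and ?F = "{x \<in> topspace (mtop M). f x \<noteq> f p}"
    have "openin (mtop M) ?E" "openin (mtop M) ?F"
      using op[of "\<lambda>y. y = f p"] op[of "\<lambda>y. y \<noteq> f p"] by simp_all
    moreover have "topspace (mtop M) \<subseteq> ?E \<union> ?F" "?E \<inter> ?F = {}" by blast+
    moreover have "?E \<noteq> {}" using pq(1) by blast
    moreover have "q \<in> ?F" using pq(2) \<open>f p \<noteq> f q\<close> by simp
    then have "?F \<noteq> {}" by (metis empty_iff)
    ultimately have "\<not> connected_space (mtop M)"
      unfolding connected_space_def not_not
      by (intro exI[of _ ?E] exI[of _ ?F] conjI)
    then show False using conn by contradiction
  qed
qed

text \<open>Right translation is multiplication restricted to a slice of the product. In a product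
  chart with second factor around \<open>c\<close>, this freezes the second coordinate.\<close>

lemma smooth_map_right_mult:
  fixes G :: "('a, 'e::real_normed_vector) lgroup"
  assumes G: "lie_group G" and c: "c \<in> carrier G"
  shows "smooth_map (mfd G) (mfd G) (\<lambda>g. g \<otimes>\<^bsub>G\<^esub> c)"
proof -
  have M: "smooth_manifold (mfd G)" and ts: "topspace (mtop (mfd G)) = carrier G"
    and m: "smooth_map (prod_mfd (mfd G) (mfd G)) (mfd G) (\<lambda>(g, h). g \<otimes>\<^bsub>G\<^esub> h)"
    using G unfolding lie_group_def by auto
  have "continuous_map (mtop (mfd G)) (prod_topology (mtop (mfd G)) (mtop (mfd G))) (\<lambda>g. (g, c))"
    using c ts by (simp add: continuous_map_pairwise o_def)
  moreover have "continuous_map (prod_topology (mtop (mfd G)) (mtop (mfd G))) (mtop (mfd G)) (\<lambda>(g, h). g \<otimes>\<^bsub>G\<^esub> h)"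
    using m unfolding smooth_map_def prod_mfd_def by simp
  ultimately have cont: "continuous_map (mtop (mfd G)) (mtop (mfd G)) (\<lambda>g. g \<otimes>\<^bsub>G\<^esub> c)"
    using continuous_map_compose by (fastforce simp: o_def)
  obtain W \<eta> where W: "(W, \<eta>) \<in> atlas (mfd G)" "c \<in> W"
    using chart_exists[OF M] c ts by metis
  have "C_k_on k (\<phi> ` (U \<inter> (\<lambda>g. g \<otimes>\<^bsub>G\<^esub> c) -` V)) (\<psi> \<circ> (\<lambda>g. g \<otimes>\<^bsub>G\<^esub> c) \<circ> inv_into U \<phi>)"
    if U: "(U, \<phi>) \<in> atlas (mfd G)" and V: "(V, \<psi>) \<in> atlas (mfd G)" for U \<phi> V \<psi> k
  proof -
    let ?T = "\<phi> ` (U \<inter> (\<lambda>g. g \<otimes>\<^bsub>G\<^esub> c) -` V)"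
    let ?S = "map_prod \<phi> \<eta> ` (U \<times> W \<inter> (\<lambda>(g, h). g \<otimes>\<^bsub>G\<^esub> h) -` V)"
    let ?f = "\<psi> \<circ> (\<lambda>(g, h). g \<otimes>\<^bsub>G\<^esub> h) \<circ> inv_into (U \<times> W) (map_prod \<phi> \<eta>)"
    have "openin (mtop (mfd G)) {x \<in> topspace (mtop (mfd G)). x \<otimes>\<^bsub>G\<^esub> c \<in> V}"
      using cont chart_openin[OF M V] unfolding continuous_map_def by blast
    moreover have "U \<inter> {x \<in> topspace (mtop (mfd G)). x \<otimes>\<^bsub>G\<^esub> c \<in> V} = U \<inter> (\<lambda>g. g \<otimes>\<^bsub>G\<^esub> c) -` V"
      using chart_subset[OF M U] by auto
    ultimately have oT: "open ?T" using chart_open_image[OF M U] by metis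
    have "(U \<times> W, map_prod \<phi> \<eta>) \<in> atlas (prod_mfd (mfd G) (mfd G))"
      using U W unfolding prod_mfd_def by auto
    then have f: "C_k_on k ?S ?f"
      using m V unfolding smooth_map_def C_inf_on_def by blast
    have inj: "inj_on (map_prod \<phi> \<eta>) (U \<times> W)"
      using chart_inj_on[OF M U] chart_inj_on[OF M W(1)] by (rule map_prod_inj_on)
    have inv: "inv_into (U \<times> W) (map_prod \<phi> \<eta>) (\<phi> g, \<eta> c) = (g, c)" if "g \<in> U" for g
      using inv_into_f_f[OF inj, of "(g, c)"] that W(2) by simp
    have "C_k_on k ?T (\<lambda>x. ?f (x, \<eta> c))"
    proof (rule C_k_on_pair_const[OF oT _ f])
      fix x assume "x \<in> ?T"
      then obtain g where "g \<in> U" "g \<otimes>\<^bsub>G\<^esub> c \<in> V" "x = \<phi> g" by auto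
      then show "(x, \<eta> c) \<in> ?S" using W(2) by (intro image_eqI[of _ _ "(g, c)"]) auto
    qed
    then show ?thesis
      by (rule C_k_on_cong[OF oT, rotated]) (auto simp: inv chart_inv[OF M U])
  qed
  then show ?thesis using cont unfolding smooth_map_def C_inf_on_def by blast
qed

section \<open>Representations\<close>

text \<open>The functionals sending \<open>X\<close> to \<open>m (X u)\<close> already separate
  operators. This recovers operator identities from what tangent vectors do to real
  functions.\<close>

lemma blinfun_eq_if_functionals_eq:
  fixes A B :: "'v::real_normed_vector \<Rightarrow>\<^sub>L 'v"
  assumes fd: "fin_dim TYPE('v)"
    and eq: "\<And>l :: ('v \<Rightarrow>\<^sub>L 'v) \<Rightarrow> real. bounded_linear l \<Longrightarrow> l A = l B"
  shows "A = B"
proof (rule ccontr)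
  assume "A \<noteq> B"
  then obtain u where "A u - B u \<noteq> 0" using blinfun_eqI[of A B] by auto
  then obtain m :: "'v \<Rightarrow> real" where m: "bounded_linear m" "m (A u - B u) \<noteq> 0"
    using fin_dim_functional_separates[OF fd] by metis
  have "bounded_linear (\<lambda>X::'v \<Rightarrow>\<^sub>L 'v. m (X u))"
    by (rule bounded_linear_compose[OF m(1) blinfun.bounded_linear_left])
  from eq[OF this] m(2) show False by (simp add: linear_diff[OF bounded_linear.linear[OF m(1)]])
qed

text \<open>Makes every such functional an admissible test function on \<open>GL\<close>, so that
  the differential of \<Theta> can be evaluated on it.\<close>

lemma smooth_fun_GL_bounded_linear:
  fixes l :: "('v::real_normed_vector \<Rightarrow>\<^sub>L 'v) \<Rightarrow> real"
  assumes "fin_dim TYPE('v)" "bounded_linear l"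
  shows "smooth_fun (open_mfd GL_carrier) l"
proof -
  have op: "open (GL_carrier :: ('v \<Rightarrow>\<^sub>L 'v) set)" by (rule open_GL_carrier[OF assms(1)])
  have inv: "inv_into GL_carrier id A = A" if "A \<in> GL_carrier" for A :: "'v \<Rightarrow>\<^sub>L 'v"
    using inv_into_f_f[of id GL_carrier A] that by simp
  have id: "C_k_on k GL_carrier (\<lambda>A::'v \<Rightarrow>\<^sub>L 'v. A)" for k
    by (cases k) (simp_all add: C_k_on_const frechet_derivative_ident)
  have "C_k_on k GL_carrier (l \<circ> inv_into GL_carrier id)" for k
    by (rule C_k_on_cong[OF op _ C_k_on_bounded_linear[OF assms(2) op id]]) (simp add: inv)
  moreover have "continuous_map (top_of_set GL_carrier) euclideanreal l"
    using bounded_linear.continuous_on[OF assms(2) continuous_on_id] by simp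
  ultimately show ?thesis
    unfolding smooth_fun_iff by (auto simp: open_mfd_def smooth_vec_def C_inf_on_def)
qed

lemma smooth_vec_into_GL:
  assumes "smooth_map M (open_mfd GL_carrier) F" "smooth_manifold M"
  shows "smooth_vec M F"
proof (rule smooth_vecI)
  fix U \<phi> k assume U: "(U, \<phi>) \<in> atlas M"
  have "F g \<in> GL_carrier" if "g \<in> U" for g
    using assms(1) chart_subset[OF assms(2) U] that
    by (auto simp: smooth_map_def open_mfd_def continuous_map_in_subtopology)
  then have "U \<inter> F -` GL_carrier = U" by auto
  moreover have "C_inf_on (\<phi> ` (U \<inter> F -` GL_carrier)) (id \<circ> F \<circ> inv_into U \<phi>)"
    using assms(1) U unfolding smooth_map_def open_mfd_def by auto
  ultimately show "C_k_on k (\<phi> ` U) (F \<circ> inv_into U \<phi>)" by (simp add: C_inf_on_def)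
qed

lemma blinfun_compose_id [simp]:
  "id_blinfun o\<^sub>L A = A" "A o\<^sub>L id_blinfun = A"
  by (auto intro: blinfun_eqI)

lemma blinfun_compose_assoc: "(A o\<^sub>L B) o\<^sub>L C = A o\<^sub>L (B o\<^sub>L C)"
  by (auto intro: blinfun_eqI)

theorem theorem2p18:
  fixes br :: "'l::real_vector \<Rightarrow> 'l \<Rightarrow> 'l"
    and D :: "'l \<Rightarrow> 'l"
    and T :: "'v::real_normed_vector \<Rightarrow> 'v"
    and \<theta> :: "'l \<Rightarrow> 'v \<Rightarrow>\<^sub>L 'v"
    and G :: "('a, 'e::real_normed_vector) lgroup"
    and \<D> :: "'a \<Rightarrow> 'a"
    and \<iota> :: "'l \<Rightarrow> ('a \<Rightarrow> real) \<Rightarrow> real"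
    and \<Theta> :: "'a \<Rightarrow> 'v \<Rightarrow>\<^sub>L 'v"
  assumes "difference_lie_algebra br D"
    and "difference_lie_algebra_rep br D T \<theta>"
    and "integrates_difference_lie_algebra br D G \<D> \<iota>"
    and "integrates_lie_algebra_rep G \<iota> \<theta> \<Theta>"
  shows "difference_lie_group_rep G \<D> T \<Theta>"
proof -
  have fd: "fin_dim TYPE('v)" and linT: "linear T"
    and rep: "\<And>x u. T (\<theta> x u) = \<theta> (D x) u + \<theta> x (T u) + \<theta> (D x) (T u)"
    using assms(2) unfolding difference_lie_algebra_rep_def by auto
  have G: "lie_group G" and sD: "smooth_map (mfd G) (mfd G) \<D>"
    and Dmult: "\<And>g h. g \<in> carrier G \<Longrightarrow> h \<in> carrier G \<Longrightarrow>
      \<D> (g \<otimes>\<^bsub>G\<^esub> h) = \<D> g \<otimes>\<^bsub>G\<^esub> g \<otimes>\<^bsub>G\<^esub> \<D> h \<otimes>\<^bsub>G\<^esub> inv\<^bsub>G\<^esub> g"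
    and conn: "connected_space (mtop (mfd G))"
    and bij: "bij_betw \<iota> UNIV (tangent_space (mfd G) \<one>\<^bsub>G\<^esub>)"
    and diffD: "\<And>x. differential (mfd G) \<D> (\<iota> x) = \<iota> (D x)"
    using assms(3)
    unfolding integrates_difference_lie_algebra_def difference_lie_group_def is_lie_algebra_of_def
    by auto
  have hom: "lie_group_hom G GL \<Theta>"
    and diff\<Theta>: "\<And>x. differential (open_mfd GL_carrier) \<Theta> (\<iota> x) = vec_tangent GL_carrier id_blinfun (\<theta> x)"
    using assms(4) unfolding integrates_lie_algebra_rep_def by (auto simp: GL_def)
  interpret group G using G unfolding lie_group_def by blast
  have M: "smooth_manifold (mfd G)" and ts: "topspace (mtop (mfd G)) = carrier G"
    and sinv: "smooth_map (mfd G) (mfd G) (\<lambda>g. inv\<^bsub>G\<^esub> g)"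
    using G unfolding lie_group_def by auto
  have Dcl: "\<D> g \<in> carrier G" if "g \<in> carrier G" for g
    using sD that ts unfolding smooth_map_def continuous_map_def by auto
  have \<Theta>mult: "\<Theta> (g \<otimes>\<^bsub>G\<^esub> h) = \<Theta> g o\<^sub>L \<Theta> h" if "g \<in> carrier G" "h \<in> carrier G" for g h
    using hom that unfolding lie_group_hom_def GL_def hom_def by auto
  have s\<Theta>: "smooth_map (mfd G) (open_mfd GL_carrier) \<Theta>"
    using hom unfolding lie_group_hom_def GL_def by auto
  have \<Theta>GL: "\<Theta> g \<in> GL_carrier" if "g \<in> carrier G" for g
    using hom that unfolding lie_group_hom_def GL_def hom_def by auto
  \<comment> \<open>An idempotent with a left inverse is the identity.\<close>
  have \<Theta>one: "\<Theta> \<one>\<^bsub>G\<^esub> = id_blinfun"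
  proof -
    obtain B where B: "B o\<^sub>L \<Theta> \<one>\<^bsub>G\<^esub> = id_blinfun"
      using \<Theta>GL[OF one_closed] unfolding GL_carrier_def by blast
    have "\<Theta> \<one>\<^bsub>G\<^esub> = (B o\<^sub>L \<Theta> \<one>\<^bsub>G\<^esub>) o\<^sub>L \<Theta> \<one>\<^bsub>G\<^esub>" by (simp add: B)
    also have "\<dots> = B o\<^sub>L \<Theta> \<one>\<^bsub>G\<^esub>" by (simp add: blinfun_compose_assoc \<Theta>mult[symmetric])
    finally show ?thesis by (simp add: B)
  qed
  have Done: "\<D> \<one>\<^bsub>G\<^esub> = \<one>\<^bsub>G\<^esub>"
    using Dmult[of "\<one>\<^bsub>G\<^esub>" "\<one>\<^bsub>G\<^esub>"] Dcl[of "\<one>\<^bsub>G\<^esub>"] by (simp add: r_cancel_one')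

  define S where "S = Blinfun (\<lambda>u. T u + u)"
  have S: "S u = T u + u" for u
    unfolding S_def using fin_dim_linear_imp_bounded_linear[OF fd linT]
    by (subst bounded_linear_Blinfun_apply) (auto intro: bounded_linear_add bounded_linear_ident)
  \<comment> \<open>Adding \<open>\<theta> x u\<close> to both sides of \<open>rep\<close> makes the
    right side factor through \<open>T u + u\<close>; this is why \<open>S\<close> is
    \<open>T + id\<close>.\<close>
  have repS: "S o\<^sub>L \<theta> x = (\<theta> (D x) + \<theta> x) o\<^sub>L S" for x
    by (rule blinfun_eqI) (simp add: S rep blinfun.add_left blinfun.add_right)

  define \<Phi> where "\<Phi> g = \<Theta> (\<D> g) o\<^sub>L \<Theta> g" for g
  have \<Phi>: "\<Phi> g = \<Theta> (\<D> g \<otimes>\<^bsub>G\<^esub> g)" if "g \<in> carrier G" for g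
    unfolding \<Phi>_def using that Dcl by (simp add: \<Theta>mult)
  have \<Phi>mult: "\<Phi> (g \<otimes>\<^bsub>G\<^esub> h) = \<Phi> g o\<^sub>L \<Phi> h" if "g \<in> carrier G" "h \<in> carrier G" for g h
  proof -
    \<comment> \<open>The trailing inverse of \<open>g\<close> in the difference identity cancels
      against the leading \<open>g\<close> of the product.\<close>
    have "\<D> (g \<otimes>\<^bsub>G\<^esub> h) \<otimes>\<^bsub>G\<^esub> (g \<otimes>\<^bsub>G\<^esub> h) = (\<D> g \<otimes>\<^bsub>G\<^esub> g) \<otimes>\<^bsub>G\<^esub> (\<D> h \<otimes>\<^bsub>G\<^esub> h)"
      using that Dcl by (simp add: Dmult m_assoc inv_solve_left')
    then show ?thesis using that Dcl by (simp add: \<Phi> \<Theta>mult)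
  qed
  have \<Phi>one: "\<Phi> \<one>\<^bsub>G\<^esub> = id_blinfun" by (simp add: \<Phi>_def Done \<Theta>one)
  \<comment> \<open>Writing the inverse of \<Phi> as \<Phi> at the inverse element lets its
    smoothness come from inversion in \<open>G\<close> rather than in \<open>GL\<close>.\<close>
  define P where "P g = \<Phi> (inv\<^bsub>G\<^esub> g)" for g
  define K where "K g = P g o\<^sub>L S o\<^sub>L \<Theta> g" for g
  have P\<Phi>: "P g o\<^sub>L \<Phi> g = id_blinfun" if "g \<in> carrier G" for g
    unfolding P_def using that by (simp add: \<Phi>mult[symmetric] \<Phi>one)
  have \<Phi>P: "\<Phi> g o\<^sub>L P g = id_blinfun" if "g \<in> carrier G" for g
    unfolding P_def using that by (simp add: \<Phi>mult[symmetric] \<Phi>one)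

  have v\<Theta>: "smooth_vec (mfd G) \<Theta>" by (rule smooth_vec_into_GL[OF s\<Theta> M])
  have v\<Theta>D: "smooth_vec (mfd G) (\<lambda>g. \<Theta> (\<D> g))" by (rule smooth_vec_compose[OF M M sD v\<Theta>])
  have vP: "smooth_vec (mfd G) P"
    unfolding P_def
    by (rule smooth_vec_compose[OF M M sinv, of \<Phi>])
      (unfold \<Phi>_def, rule smooth_vec_bounded_bilinear[OF bounded_bilinear_blinfun_compose M v\<Theta>D v\<Theta>])

  have zero: "((K \<circ> inv_into U \<phi>) has_derivative (\<lambda>_. 0)) (at (\<phi> p))"
    if U: "(U, \<phi>) \<in> atlas (mfd G)" and p: "p \<in> U" for U \<phi> p
  proof -
    have pG: "p \<in> carrier G" using chart_subset[OF M U] p ts by blast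
    \<comment> \<open>Right translation by \<open>p\<^sup>-\<^sup>1\<close> moves the chart directions at \<open>p\<close> to tangent vectors at the
      identity, where the differentials of \<open>\<Theta>\<close> and \<open>\<D>\<close> are known.\<close>
    define R where "R g = g \<otimes>\<^bsub>G\<^esub> inv\<^bsub>G\<^esub> p" for g
    have sR: "smooth_map (mfd G) (mfd G) R"
      unfolding R_def[abs_def] by (rule smooth_map_right_mult[OF G inv_closed[OF pG]])
    have Rp: "R p = \<one>\<^bsub>G\<^esub>" unfolding R_def using pG by simp
    define h where "h y = R (inv_into U \<phi> y)" for y
    have h1: "h (\<phi> p) = \<one>\<^bsub>G\<^esub>" unfolding h_def by (simp add: chart_inv[OF M U p] Rp)
    have hG: "h y \<in> carrier G" if "y \<in> \<phi> ` U" for y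
      using that chart_subset[OF M U] ts pG unfolding h_def R_def
      by (auto simp: chart_inv[OF M U])
    have oU: "open (\<phi> ` U)" by (rule chart_open[OF M U])
    have pU: "\<phi> p \<in> \<phi> ` U" using p by blast
    let ?d = "\<lambda>f. frechet_derivative (\<lambda>y. f (h y)) (at (\<phi> p))"
    have d: "((\<lambda>y. f (h y)) has_derivative ?d f) (at (\<phi> p))" if "smooth_vec (mfd G) f"
      for f :: "'a \<Rightarrow> 'v \<Rightarrow>\<^sub>L 'v"
      using smooth_vec_has_derivative[OF M smooth_vec_compose[OF M M sR that] U p]
      by (simp add: o_def h_def)
    have dl: "frechet_derivative (\<lambda>y. l (f (h y))) (at (\<phi> p)) a = l (?d f a)"
      if "smooth_vec (mfd G) f" "bounded_linear l"
      for f :: "'a \<Rightarrow> 'v \<Rightarrow>\<^sub>L 'v" and l :: "('v \<Rightarrow>\<^sub>L 'v) \<Rightarrow> real" and a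
      by (rule fun_cong[OF frechet_derivative_at[OF bounded_linear.has_derivative[OF that(2) d[OF that(1)]]],
            symmetric])
    have key: "(P (h (\<phi> p)) o\<^sub>L S o\<^sub>L ?d \<Theta> a) + (?d P a o\<^sub>L S o\<^sub>L \<Theta> (h (\<phi> p))) = 0" for a
    proof -
      \<comment> \<open>The direction \<open>a\<close>, moved to the identity, is a tangent vector
        there, hence \<open>\<iota> x\<close> for some \<open>x\<close> because \<iota> is
        onto.\<close>
      have "(\<lambda>f. if smooth_fun (mfd G) f
          then frechet_derivative ((\<lambda>g. f (R g)) \<circ> inv_into U \<phi>) (at (\<phi> p)) a else 0) \<in> range \<iota>"
        unfolding bij_betw_imp_surj_on[OF bij] Rp[symmetric]
        by (rule derivation_along_chart[OF M sR U p])
      then obtain x where \<iota>x: "(\<lambda>f. if smooth_fun (mfd G) f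
          then frechet_derivative ((\<lambda>g. f (R g)) \<circ> inv_into U \<phi>) (at (\<phi> p)) a else 0) = \<iota> x"
        by (rule rangeE)
      have x: "\<iota> x f = frechet_derivative (\<lambda>y. f (h y)) (at (\<phi> p)) a" if "smooth_fun (mfd G) f" for f
        unfolding \<iota>x[symmetric] h_def using that by (simp add: o_def)
      \<comment> \<open>\<open>l\<close> is linear, so it is its own derivative at the identity
        operator.\<close>
      have \<iota>\<Theta>: "\<iota> z (\<lambda>g. l (\<Theta> g)) = l (\<theta> z)" if "bounded_linear l" for l z
        using fun_cong[OF diff\<Theta>, of z l] smooth_fun_GL_bounded_linear[OF fd that]
          frechet_derivative_at[OF bounded_linear_imp_has_derivative[OF that], symmetric]
        by (simp add: differential_def vec_tangent_def o_def)
      have sl: "smooth_fun (mfd G) (\<lambda>g. l (\<Theta> g))" if "bounded_linear l" for l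
      proof -
        have "continuous_map (mtop (mfd G)) (top_of_set GL_carrier) \<Theta>"
          using s\<Theta> unfolding smooth_map_def open_mfd_def by simp
        moreover have "continuous_map (top_of_set GL_carrier) euclideanreal l"
          using bounded_linear.continuous_on[OF that continuous_on_id] by simp
        ultimately have "continuous_map (mtop (mfd G)) euclideanreal (l \<circ> \<Theta>)"
          by (rule continuous_map_compose)
        then show ?thesis
          unfolding smooth_fun_iff
          using smooth_vec_bounded_linear[OF that M v\<Theta>] by (simp add: o_def)
      qed
      have d\<Theta>: "?d \<Theta> a = \<theta> x"
      proof (rule blinfun_eq_if_functionals_eq[OF fd])
        fix l :: "('v \<Rightarrow>\<^sub>L 'v) \<Rightarrow> real" assume l: "bounded_linear l"
        show "l (?d \<Theta> a) = l (\<theta> x)"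
          using x[OF sl[OF l]] \<iota>\<Theta>[OF l, of x] dl[OF v\<Theta> l, of a] by simp
      qed
      have dA: "?d (\<lambda>g. \<Theta> (\<D> g)) a = \<theta> (D x)"
      proof (rule blinfun_eq_if_functionals_eq[OF fd])
        fix l :: "('v \<Rightarrow>\<^sub>L 'v) \<Rightarrow> real" assume l: "bounded_linear l"
        \<comment> \<open>The differential of \<D> moves the composition with \<D> onto the tangent
          vector, replacing \<open>x\<close> by \<open>D x\<close>.\<close>
        have "\<iota> x (\<lambda>g. l (\<Theta> (\<D> g))) = \<iota> (D x) (\<lambda>g. l (\<Theta> g))"
          unfolding diffD[symmetric] by (simp add: differential_def sl[OF l] o_def)
        then show "l (?d (\<lambda>g. \<Theta> (\<D> g)) a) = l (\<theta> (D x))"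
          using x[OF smooth_fun_compose[OF M M sD sl[OF l]]] \<iota>\<Theta>[OF l, of "D x"] dl[OF v\<Theta>D l, of a]
          by simp
      qed
      let ?d\<Phi> = "\<lambda>a. (\<Theta> (\<D> (h (\<phi> p))) o\<^sub>L ?d \<Theta> a) + (?d (\<lambda>g. \<Theta> (\<D> g)) a o\<^sub>L \<Theta> (h (\<phi> p)))"
      have d\<Phi>: "((\<lambda>y. \<Phi> (h y)) has_derivative ?d\<Phi>) (at (\<phi> p))"
        unfolding \<Phi>_def
        by (rule bounded_bilinear.FDERIV[OF bounded_bilinear_blinfun_compose d[OF v\<Theta>D] d[OF v\<Theta>]])
      have "((\<lambda>y. P (h y) o\<^sub>L \<Phi> (h y)) has_derivative
          (\<lambda>a. (P (h (\<phi> p)) o\<^sub>L ?d\<Phi> a) + (?d P a o\<^sub>L \<Phi> (h (\<phi> p))))) (at (\<phi> p))"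
        by (rule bounded_bilinear.FDERIV[OF bounded_bilinear_blinfun_compose d[OF vP] d\<Phi>])
      \<comment> \<open>The product of \<open>P\<close> and \<Phi> is constant, so its Leibniz
        derivative vanishes; at the identity this yields the derivative of \<open>P\<close> as minus
        that of \<Phi>.\<close>
      then have "((\<lambda>y. id_blinfun) has_derivative
          (\<lambda>a. (P (h (\<phi> p)) o\<^sub>L ?d\<Phi> a) + (?d P a o\<^sub>L \<Phi> (h (\<phi> p))))) (at (\<phi> p))"
        by (rule has_derivative_transform_within_open[OF _ oU pU]) (simp add: P\<Phi> hG)
      from fun_cong[OF has_derivative_unique[OF this has_derivative_const], of a]
      have "?d P a + (\<theta> (D x) + \<theta> x) = 0"
        by (simp add: h1 P_def \<Phi>one \<Theta>one Done d\<Theta> dA add_ac)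
      then have "?d P a = - (\<theta> (D x) + \<theta> x)"
        by (simp only: eq_neg_iff_add_eq_0)
      then show ?thesis
        using repS[of x] unfolding d\<Theta>
        by (simp add: h1 P_def \<Phi>one \<Theta>one bounded_bilinear.add_left[OF bounded_bilinear_blinfun_compose]
              bounded_bilinear.diff_left[OF bounded_bilinear_blinfun_compose]
              bounded_bilinear.minus_left[OF bounded_bilinear_blinfun_compose])
    qed
    have "((\<lambda>y. P (h y) o\<^sub>L S o\<^sub>L \<Theta> (h y)) has_derivative
        (\<lambda>a. (P (h (\<phi> p)) o\<^sub>L S o\<^sub>L ?d \<Theta> a) + (?d P a o\<^sub>L S o\<^sub>L \<Theta> (h (\<phi> p))))) (at (\<phi> p))"
      by (intro bounded_bilinear.FDERIV[OF bounded_bilinear_blinfun_compose]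
          bounded_linear.has_derivative[OF bounded_bilinear.bounded_linear_left[OF bounded_bilinear_blinfun_compose]]
          d[OF vP] d[OF v\<Theta>])
    then have "((\<lambda>y. K (h y)) has_derivative (\<lambda>_. 0)) (at (\<phi> p))"
      unfolding K_def key .
    \<comment> \<open>Undoes the translation: multiplying by \<open>P p\<close> on the left and
      \<open>\<Theta> p\<close> on the right turns \<open>K\<close> at \<open>R g\<close> into
      \<open>K\<close> at \<open>g\<close>, and this fixed linear map preserves a zero
      derivative.\<close>
    then have "((\<lambda>y. P p o\<^sub>L K (h y) o\<^sub>L \<Theta> p) has_derivative (\<lambda>_. P p o\<^sub>L 0 o\<^sub>L \<Theta> p)) (at (\<phi> p))"
      by (intro bounded_linear.has_derivative[OF bounded_bilinear.bounded_linear_left[OF bounded_bilinear_blinfun_compose]]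
          bounded_linear.has_derivative[OF bounded_bilinear.bounded_linear_right[OF bounded_bilinear_blinfun_compose]])
    then have "((\<lambda>y. P p o\<^sub>L K (h y) o\<^sub>L \<Theta> p) has_derivative (\<lambda>_. 0)) (at (\<phi> p))" by simp
    then show ?thesis
    proof (rule has_derivative_transform_within_open[OF _ oU pU])
      fix y assume "y \<in> \<phi> ` U"
      then obtain g where g: "g \<in> U" "y = \<phi> g" by blast
      then have gG: "g \<in> carrier G" using chart_subset[OF M U] ts by blast
      have "P p o\<^sub>L P (R g) = P g" "\<Theta> (R g) o\<^sub>L \<Theta> p = \<Theta> g"
        unfolding P_def R_def using gG pG
        by (simp_all add: \<Phi>mult[symmetric] \<Theta>mult[symmetric] inv_mult_group m_assoc[symmetric])
           (simp add: m_assoc)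
      then show "P p o\<^sub>L K (h y) o\<^sub>L \<Theta> p = (K \<circ> inv_into U \<phi>) y"
        by (simp add: K_def h_def g(2) chart_inv[OF M U g(1)]) (metis blinfun_compose_assoc)
    qed
  qed

  have "S o\<^sub>L \<Theta> g = \<Phi> g o\<^sub>L S" if g: "g \<in> carrier G" for g
  proof -
    have "K g = K \<one>\<^bsub>G\<^esub>"
      by (rule constant_if_derivative_zero[OF M conn zero]) (simp_all add: ts g)
    also have "\<dots> = S" by (simp add: K_def P_def \<Phi>one \<Theta>one)
    finally have "\<Phi> g o\<^sub>L S = \<Phi> g o\<^sub>L K g" by simp
    also have "\<dots> = (\<Phi> g o\<^sub>L P g) o\<^sub>L (S o\<^sub>L \<Theta> g)" unfolding K_def by (simp add: blinfun_compose_assoc)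
    finally show ?thesis using \<Phi>P[OF g] by simp
  qed
  then have "S (\<Theta> g u) = \<Phi> g (S u)" if "g \<in> carrier G" for g u
    using that by (metis blinfun_apply_blinfun_compose)
  then have "\<forall>g\<in>carrier G. \<forall>u. T (\<Theta> g u) + \<Theta> g u = \<Theta> (\<D> g \<otimes>\<^bsub>G\<^esub> g) (T u) + \<Theta> (\<D> g \<otimes>\<^bsub>G\<^esub> g) u"
    by (simp add: \<Phi> S blinfun.add_right)
  then show ?thesis
    unfolding difference_lie_group_rep_def using fd linT hom by blast
qed

end
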